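(* Let $\ell,u\ge1$ be integers and put $S_{\ell,u}=\{-\ell,\dots,-1,1,\dots,u\}$. There exist constants $\omega_s\in\mathbb C$, one for each $s\in S_{\ell,u}$, such that $$\operatorname{perm}T_n\bigl((a_s)_{s\in S_{\ell,u}}\bigr)=\det T_n\bigl((\omega_sa_s)_{s\in S_{\ell,u}}\bigr)$$ for every $n\ge0$ and every choice of the diagonal parameters $(a_s)_{s\in S_{\ell,u}}$ if and only if $$\min(\ell,u)=1\qquad\text{or}\qquad(\ell,u)=(2,2).$$
   Context: $T_n((a_s)_{s\in S_{\ell,u}})$ is the $n\times n$ Toeplitz matrix whose $(i,j)$ entry is $a_{j-i}$ if $j-i\in S_{\ell,u}$ and $0$ otherwise; in particular the main diagonal is zero in both matrices. The parameters $a_s$ range over $\mathbb C$. $\operatorname{perm}$ denotes the permanent. *)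

theory Defs
  imports Complex_Main "Jordan_Normal_Form.Determinant"
begin

definition diagonals :: "nat \<Rightarrow> nat \<Rightarrow> int set" where
  "diagonals l u = {- int l..int u} - {0}"

(* The parameters are a total function on int, but only its values on diagonals l u are used.
   Rows and columns are numbered from 0, which does not affect the difference j - i. *)
definition toeplitz_mat :: "nat \<Rightarrow> nat \<Rightarrow> nat \<Rightarrow> (int \<Rightarrow> complex) \<Rightarrow> complex mat" where
  "toeplitz_mat l u n a =
     mat n n (\<lambda>(i, j). if int j - int i \<in> diagonals l u then a (int j - int i) else 0)"

(* As for det, the value on non-square matrices is 0 by convention. *)
definition permanent :: "'a :: comm_ring_1 mat \<Rightarrow> 'a" where
  "permanent A = (if dim_row A = dim_col A
     then (\<Sum>p \<in> {p. p permutes {0..<dim_row A}}. \<Prod>i = 0..<dim_row A. A $$ (i, p i))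
     else 0)"

end

theory Submission
  imports Defs
begin

text \<open>
  Sufficiency: put \<open>\<omega>\<^sub>s = -1\<close> for \<open>s = -1\<close> and \<open>\<omega>\<^sub>s = 1\<close> otherwise. It suffices that the sign of
  every permutation contributing to the permanent is \<open>(-1)\<^sup>d\<close>, where \<open>d\<close> counts the \<open>i\<close> with
  \<open>p(i) = i - 1\<close>. This follows by induction on \<open>n\<close>, removing the last point from its cycle.

  Necessity: up to transposition \<open>l \<ge> 2\<close> and \<open>u \<ge> 3\<close>. If a set of diagonals supports exactly one
  permutation \<open>q\<close>, then \<open>sign q \<cdot> \<Prod>\<^sub>i \<omega>(q i - i) = 1\<close>. Cycles with steps \<open>(1, -1)\<close>, \<open>(1, 1, -2)\<close>,
  \<open>(3, -1, -1, -1)\<close> and \<open>(3, -2, 1, -2)\<close> give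
  \<open>\<omega>\<^sub>1 \<omega>\<^sub>-\<^sub>1 = -1\<close>, \<open>\<omega>\<^sub>1\<^sup>2 \<omega>\<^sub>-\<^sub>2 = 1\<close>, \<open>\<omega>\<^sub>3 \<omega>\<^sub>-\<^sub>1\<^sup>3 = -1\<close> and \<open>\<omega>\<^sub>3 \<omega>\<^sub>1 \<omega>\<^sub>-\<^sub>2\<^sup>2 = -1\<close>,
  which are inconsistent.
\<close>

section \<open>Permanents under transposition\<close>

text \<open>Reindexing the product by \<open>p\<close> matches the term of the inverse of
  \<open>p\<close> in the transpose with the term of \<open>p\<close> in \<open>A\<close>, and
  inversion is a bijection on permutations.\<close>

lemma permanent_transpose:
  fixes A :: "'a :: comm_ring_1 mat"
  assumes A: "A \<in> carrier_mat n n"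
  shows "permanent (transpose_mat A) = permanent A"
proof -
  have "(\<Prod>i = 0..<n. transpose_mat A $$ (i, Hilbert_Choice.inv p i))
      = (\<Prod>i = 0..<n. A $$ (i, p i))"
    if p: "p permutes {0..<n}" for p
  proof -
    have "(\<Prod>i = 0..<n. transpose_mat A $$ (i, Hilbert_Choice.inv p i))
        = (\<Prod>i = 0..<n. transpose_mat A $$ (p i, Hilbert_Choice.inv p (p i)))"
      by (rule prod.permute[OF p, unfolded o_def])
    also have "\<dots> = (\<Prod>i = 0..<n. A $$ (i, p i))"
      using A p permutes_in_image[OF p] permutes_inverses(2)[OF p]
      by (intro prod.cong) auto
    finally show ?thesis .
  qed
  then show ?thesis
    using A unfolding permanent_def
    by (simp, subst sum_permutations_inverse, intro sum.cong, auto)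
qed

section \<open>Signs of permutations with restricted steps\<close>

text \<open>The test is \<open>Suc (p i) = i\<close> because truncated subtraction in
  \<open>p i = i - 1\<close> would count a fixed point at 0.\<close>

definition descent_sign :: "nat \<Rightarrow> (nat \<Rightarrow> nat) \<Rightarrow> int" where
  "descent_sign n p = (\<Prod>i = 0..<n. if Suc (p i) = i then -1 else 1)"

lemma descent_sign_Suc:
  "descent_sign (Suc m) p = (if Suc (p m) = m then -1 else 1) * descent_sign m p"
  by (simp add: descent_sign_def)

lemma permutes_remove_last_fixed:
  assumes "p permutes {0..<Suc m}" "p m = m"
  shows "p permutes {0..<m}"
  by (rule permutes_superset[OF assms(1)]) (use assms(2) in \<open>auto simp: less_Suc_eq\<close>)

text \<open>The path \<open>j -> m -> p m\<close> is shortened to \<open>j -> p m\<close>, at the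
  cost of one transposition. The two conditional factors belong to the deleted step
  \<open>m -> p m\<close> and the new step \<open>j -> p m\<close>.\<close>

lemma permutes_remove_last:
  assumes p: "p permutes {0..<Suc m}" and "p m \<noteq> m"
  obtains j q where "j < m" "p j = m" "q j = p m" "\<And>i. i \<noteq> j \<Longrightarrow> i \<noteq> m \<Longrightarrow> q i = p i"
    "q permutes {0..<m}" "sign p = - sign q"
    "descent_sign (Suc m) p =
      (if Suc (p m) = m then -1 else 1) * (if Suc (p m) = j then -1 else 1) * descent_sign m q"
proof -
  define q where "q = transpose m (p m) \<circ> p"
  have pm: "p m < m"
    using permutes_in_image[OF p, of m] \<open>p m \<noteq> m\<close> by simp
  have "m \<in> p ` {0..<Suc m}"
    using permutes_image[OF p] by simp
  then obtain j where j: "j < Suc m" "p j = m"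
    by auto
  then have "j < m"
    using \<open>p m \<noteq> m\<close> by (cases "j = m") auto
  have other: "q i = p i" if "i \<noteq> j" "i \<noteq> m" for i
  proof -
    have "p i \<noteq> p m" "p i \<noteq> p j"
      using that permutes_inj[OF p] by (auto dest: injD)
    then show ?thesis
      using j by (simp add: q_def transpose_def)
  qed
  have qj: "q j = p m"
    using j by (simp add: q_def)
  have t: "transpose m (p m) permutes {0..<Suc m}"
    using pm by (intro permutes_swap_id) auto
  have "q permutes {0..<Suc m}"
    unfolding q_def by (rule permutes_compose[OF p t])
  then have q: "q permutes {0..<m}"
    by (rule permutes_remove_last_fixed) (simp add: q_def)
  have "sign q = - sign p"
    unfolding q_def using pm p t
    by (subst sign_compose) (auto simp: sign_swap_id intro: permutes_imp_permutation[rotated])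
  \<comment> \<open>Below \<open>m\<close>, \<open>p\<close> and \<open>q\<close> differ only at
    \<open>j\<close>, where \<open>p\<close> goes up and so has factor 1.\<close>
  moreover have "descent_sign m q = (if Suc (p m) = j then -1 else 1) * descent_sign m p"
  proof -
    let ?d = "\<lambda>p i. if Suc (p i) = i then -1 else 1 :: int"
    have "descent_sign m r = ?d r j * (\<Prod>i\<in>{0..<m} - {j}. ?d r i)" for r
      unfolding descent_sign_def using \<open>j < m\<close> by (intro prod.remove) auto
    moreover have "(\<Prod>i\<in>{0..<m} - {j}. ?d q i) = (\<Prod>i\<in>{0..<m} - {j}. ?d p i)"
      using other by (intro prod.cong) auto
    ultimately show ?thesis
      using qj j \<open>j < m\<close> by simp
  qed
  ultimately show ?thesis
    using that[of j q] \<open>j < m\<close> j qj other q by (auto simp: descent_sign_Suc)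
qed

text \<open>If \<open>m\<close> is not fixed, it must step to \<open>m - 1\<close>, so its removal
  deletes one descent. The new step \<open>j -> m - 1\<close> is not a descent since
  \<open>j < m\<close>, but it may be a fixed point, so the induction has to admit these.\<close>

lemma sign_eq_descent_sign_hessenberg:
  assumes "p permutes {0..<n}" "\<And>i. i < n \<Longrightarrow> i \<le> Suc (p i)"
  shows "sign p = descent_sign n p"
  using assms
proof (induction n arbitrary: p)
  case 0
  then show ?case by (simp add: descent_sign_def)
next
  case (Suc m)
  show ?case
  proof (cases "p m = m")
    case True
    then show ?thesis
      using Suc.IH[of p] Suc.prems permutes_remove_last_fixed[of p m]
      by (simp add: descent_sign_Suc)
  next
    case False
    then obtain j q where q: "j < m" "p j = m" "q j = p m"
      "\<And>i. i \<noteq> j \<Longrightarrow> i \<noteq> m \<Longrightarrow> q i = p i"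
      "q permutes {0..<m}" "sign p = - sign q"
      "descent_sign (Suc m) p =
        (if Suc (p m) = m then -1 else 1) * (if Suc (p m) = j then -1 else 1) * descent_sign m q"
      using permutes_remove_last[OF Suc.prems(1)] by metis
    have pm: "Suc (p m) = m"
      using Suc.prems(2)[of m] False permutes_in_image[OF Suc.prems(1), of m] by simp
    have "i \<le> Suc (q i)" if "i < m" for i
      using q(1,3) q(4)[of i] pm that Suc.prems(2)[of i] by (cases "i = j") auto
    then have "sign q = descent_sign m q"
      by (rule Suc.IH[OF q(5)])
    then show ?thesis
      using q pm by simp
  qed
qed

text \<open>Fixed points must be excluded: swapping 0 and 2 and fixing 1 is odd without descents.
  When removing \<open>m\<close> would create one, a block of two or four points is removed instead,
  hence the strong induction.\<close>

lemma sign_eq_descent_sign_pentadiagonal: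
  assumes "p permutes {0..<n}" "\<And>i. i < n \<Longrightarrow> p i \<noteq> i \<and> p i \<le> i + 2 \<and> i \<le> p i + 2"
  shows "sign p = descent_sign n p"
  using assms
proof (induction n arbitrary: p rule: less_induct)
  case (less n)
  note p = less.prems(1) and band = less.prems(2)
  show ?case
  proof (cases n)
    case 0
    then show ?thesis using less.prems by (simp add: descent_sign_def)
  next
    case (Suc m)
    have "p m \<noteq> m"
      using band[of m] Suc by simp
    then obtain j q where q: "j < m" "p j = m" "q j = p m"
      "\<And>i. i \<noteq> j \<Longrightarrow> i \<noteq> m \<Longrightarrow> q i = p i"
      "q permutes {0..<m}" "sign p = - sign q"
      "descent_sign (Suc m) p =
        (if Suc (p m) = m then -1 else 1) * (if Suc (p m) = j then -1 else 1) * descent_sign m q"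
      using permutes_remove_last[of p m] p Suc by metis
    have "p m < m"
      using permutes_in_image[OF p, of m] \<open>p m \<noteq> m\<close> Suc by simp
    then have pm: "m = p m + 1 \<or> m = p m + 2"
      using band[of m] Suc by auto
    have jm: "m = j + 1 \<or> m = j + 2"
      using band[of j] q(1,2) Suc by auto
    show ?thesis
    proof (cases "p m = j")
      \<comment> \<open>Now \<open>j\<close> and \<open>p m\<close> are \<open>m - 1\<close> and
        \<open>m - 2\<close> in some order. Exactly one of the steps \<open>m -> p m\<close> and
        \<open>j -> p m\<close> is a descent, which balances the sign change.\<close>
      case False
      have "q i \<noteq> i \<and> q i \<le> i + 2 \<and> i \<le> q i + 2" if "i < m" for i
        using q(1,3) q(4)[of i] pm jm False that band[of i] Suc by (cases "i = j") auto
      then have "sign q = descent_sign m q"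
        using less.IH[of m q] q(5) Suc by auto
      then show ?thesis
        using pm jm False q(6,7) Suc by auto
    next
      case True
      show ?thesis
      proof (cases "m = j + 1")
        \<comment> \<open>A swap of \<open>m - 1\<close> and \<open>m\<close>: one transposition and
          one descent.\<close>
        case True
        then have "q permutes {0..<j}"
          using permutes_remove_last_fixed[of q j] q(3,5) \<open>p m = j\<close> by simp
        moreover have "q i \<noteq> i \<and> q i \<le> i + 2 \<and> i \<le> q i + 2" if "i < j" for i
          using q(4)[of i] that True band[of i] Suc by auto
        ultimately have "sign q = descent_sign j q"
          using less.IH[of j q] True Suc by auto
        moreover have "descent_sign m q = descent_sign j q"
          using True q(3) \<open>p m = j\<close> by (simp add: descent_sign_Suc)
        ultimately show ?thesis
          using True q \<open>p m = j\<close> Suc by simp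
      next
        \<comment> \<open>Here \<open>p\<close> swaps \<open>m - 2\<close> and \<open>m\<close>, and the band condition forces it to swap
          \<open>m - 3\<close> and \<open>m - 1\<close> as well.\<close>
        case False
        then have m: "m = Suc (Suc j)"
          using jm by simp
        have qp: "q (Suc j) = p (Suc j)"
          using q(4)[of "Suc j"] m by simp
        have "q (Suc j) \<noteq> Suc j"
          using qp band[of "Suc j"] m Suc by simp
        then obtain k r where r: "k < Suc j" "q k = Suc j" "r k = q (Suc j)"
          "\<And>i. i \<noteq> k \<Longrightarrow> i \<noteq> Suc j \<Longrightarrow> r i = q i"
          "r permutes {0..<Suc j}" "sign q = - sign r"
          "descent_sign (Suc (Suc j)) q =
            (if Suc (q (Suc j)) = Suc j then -1 else 1) * (if Suc (q (Suc j)) = k then -1 else 1)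
              * descent_sign (Suc j) r"
          using permutes_remove_last[of q "Suc j"] q(5) m by metis
        have "k \<noteq> j"
          using r(2) q(3) \<open>p m = j\<close> by auto
        then have k: "j = Suc k"
          using q(4)[of k] r(1,2) m band[of k] Suc by auto
        have "q (Suc j) \<noteq> q j"
          using permutes_inj[OF q(5)] by (auto dest: injD)
        then have "q (Suc j) \<noteq> j"
          using q(3) \<open>p m = j\<close> by simp
        moreover have "q (Suc j) < Suc (Suc j)"
          using permutes_in_image[OF q(5), of "Suc j"] m by simp
        ultimately have qj: "q (Suc j) = k"
          using \<open>q (Suc j) \<noteq> Suc j\<close> qp band[of "Suc j"] m Suc k by auto
        have rj: "r j = j"
          using r(4)[of j] q(3) \<open>p m = j\<close> k by simp
        have rk: "r k = k"
          using r(3) qj by simp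
        have "r permutes {0..<k}"
          using permutes_remove_last_fixed[of r j] permutes_remove_last_fixed[of r k] r(5) rj rk k
          by simp
        moreover have "r i \<noteq> i \<and> r i \<le> i + 2 \<and> i \<le> r i + 2" if "i < k" for i
          using q(4)[of i] r(4)[of i] that m k band[of i] Suc by auto
        ultimately have "sign r = descent_sign k r"
          using less.IH[of k r] m k Suc by auto
        moreover have "descent_sign (Suc j) r = descent_sign k r"
          using rj rk k by (simp add: descent_sign_Suc)
        \<comment> \<open>The two swaps over distance 2 together are even and contain no
          descent.\<close>
        ultimately show ?thesis
          using q(6,7) r(6,7) qj \<open>p m = j\<close> m k Suc by simp
      qed
    qed
  qed
qed

section \<open>From signs to the determinant identity\<close>

text \<open>Negating the subdiagonal multiplies the term of \<open>p\<close> by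
  \<open>descent_sign n p\<close>, which cancels \<open>sign p\<close>. Permutations leaving the
  diagonals contribute 0 to both sides.\<close>

lemma permanent_eq_det_negated_subdiagonal:
  assumes "\<And>p. p permutes {0..<n} \<Longrightarrow> (\<And>i. i < n \<Longrightarrow> int (p i) - int i \<in> diagonals l u)
    \<Longrightarrow> sign p = descent_sign n p"
  shows "permanent (toeplitz_mat l u n a)
    = det (toeplitz_mat l u n (\<lambda>s. (if s = -1 then -1 else 1) * a s))"
proof -
  let ?A = "toeplitz_mat l u n a"
  let ?B = "toeplitz_mat l u n (\<lambda>s. (if s = -1 then -1 else 1) * a s)"
  have entry: "?B $$ (i, p i) = of_int (if Suc (p i) = i then -1 else 1) * ?A $$ (i, p i)"
    if "p permutes {0..<n}" "i < n" for p i
    using that permutes_in_image[OF that(1), of i] by (auto simp: toeplitz_mat_def)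
  have "(\<Prod>i = 0..<n. ?A $$ (i, p i)) = signof p * (\<Prod>i = 0..<n. ?B $$ (i, p i))"
    if p: "p permutes {0..<n}" for p
  proof -
    have B: "(\<Prod>i = 0..<n. ?B $$ (i, p i))
        = of_int (descent_sign n p) * (\<Prod>i = 0..<n. ?A $$ (i, p i))"
      unfolding descent_sign_def of_int_prod prod.distrib[symmetric]
      using entry[OF p] by (intro prod.cong) auto
    show ?thesis
    proof (cases "\<forall>i<n. int (p i) - int i \<in> diagonals l u")
      case True
      then have "sign p = descent_sign n p"
        using assms p by blast
      then have "descent_sign n p * descent_sign n p = 1"
        using sign_idempotent[of p] by simp
      then have "(of_int (descent_sign n p) * of_int (descent_sign n p) :: complex) = 1"
        by (metis of_int_1 of_int_mult)
      then show ?thesis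
        using B \<open>sign p = _\<close> by (simp add: mult.assoc[symmetric])
    next
      case False
      then obtain i where "i < n" "int (p i) - int i \<notin> diagonals l u"
        by blast
      then have "?A $$ (i, p i) = 0"
        using permutes_in_image[OF p, of i] by (simp add: toeplitz_mat_def)
      then have "(\<Prod>i = 0..<n. ?A $$ (i, p i)) = 0"
        using \<open>i < n\<close> by (intro prod_zero) auto
      then show ?thesis
        using B by simp
    qed
  qed
  moreover have "?A \<in> carrier_mat n n" "?B \<in> carrier_mat n n"
    by (simp_all add: toeplitz_mat_def)
  ultimately show ?thesis
    unfolding permanent_def det_def by (auto intro!: sum.cong)
qed

section \<open>Symmetry in \<open>l\<close> and \<open>u\<close>, and the convertible cases\<close>

definition det_convertible :: "nat \<Rightarrow> nat \<Rightarrow> (int \<Rightarrow> complex) \<Rightarrow> bool" where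
  "det_convertible l u \<omega> \<longleftrightarrow>
     (\<forall>n a. permanent (toeplitz_mat l u n a) = det (toeplitz_mat l u n (\<lambda>s. \<omega> s * a s)))"

lemma transpose_toeplitz_mat:
  "transpose_mat (toeplitz_mat l u n a) = toeplitz_mat u l n (\<lambda>s. a (- s))"
  by (rule eq_matI) (auto simp: toeplitz_mat_def diagonals_def)

text \<open>Transposition reflects the diagonals by \<open>s -> -s\<close> and preserves both
  permanent and determinant.\<close>

lemma det_convertible_swap:
  assumes "det_convertible l u \<omega>"
  shows "det_convertible u l (\<lambda>s. \<omega> (- s))"
  unfolding det_convertible_def
proof (intro allI)
  fix n and a :: "int \<Rightarrow> complex"
  have carrier: "toeplitz_mat l u n b \<in> carrier_mat n n" for b
    by (simp add: toeplitz_mat_def)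
  have "permanent (toeplitz_mat u l n a) = permanent (toeplitz_mat l u n (\<lambda>s. a (- s)))"
    using permanent_transpose[OF carrier, of "\<lambda>s. a (- s)"] by (simp add: transpose_toeplitz_mat)
  also have "\<dots> = det (toeplitz_mat l u n (\<lambda>s. \<omega> s * a (- s)))"
    using assms by (simp add: det_convertible_def)
  also have "\<dots> = det (toeplitz_mat u l n (\<lambda>s. \<omega> (- s) * a s))"
    using det_transpose[OF carrier, of "\<lambda>s. \<omega> s * a (- s)"] by (simp add: transpose_toeplitz_mat)
  finally show "permanent (toeplitz_mat u l n a)
    = det (toeplitz_mat u l n (\<lambda>s. \<omega> (- s) * a s))" .
qed

lemma det_convertible_hessenberg:
  "det_convertible 1 u (\<lambda>s. if s = -1 then -1 else 1)"
  unfolding det_convertible_def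
  by (intro allI permanent_eq_det_negated_subdiagonal sign_eq_descent_sign_hessenberg)
    (force simp: diagonals_def)+

lemma det_convertible_pentadiagonal:
  "det_convertible 2 2 (\<lambda>s. if s = -1 then -1 else 1)"
  unfolding det_convertible_def
  by (intro allI permanent_eq_det_negated_subdiagonal sign_eq_descent_sign_pentadiagonal)
    (force simp: diagonals_def)+

section \<open>Obstructions from uniquely supported permutations\<close>

text \<open>With the indicator function of \<open>D\<close> as parameters, no permutation other than
  \<open>q\<close> contributes to either expansion.\<close>

lemma det_convertible_unique_permutation:
  assumes "det_convertible l u \<omega>" and D: "D \<subseteq> diagonals l u"
    and q: "q permutes {0..<n}" "\<And>i. i < n \<Longrightarrow> int (q i) - int i \<in> D"
    and unique: "\<And>p i. p permutes {0..<n} \<Longrightarrow> (\<And>i. i < n \<Longrightarrow> int (p i) - int i \<in> D)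
      \<Longrightarrow> i < n \<Longrightarrow> p i = q i"
  shows "signof q * (\<Prod>i = 0..<n. \<omega> (int (q i) - int i)) = 1"
proof -
  \<comment> \<open>The coefficient \<open>c\<close> lets one computation serve both expansions:
    constant 1 for the permanent, the sign for the determinant.\<close>
  have single: "(\<Sum>p | p permutes {0..<n}. c p * (\<Prod>i = 0..<n. toeplitz_mat l u n b $$ (i, p i)))
      = c q * (\<Prod>i = 0..<n. b (int (q i) - int i))"
    if b: "\<And>s. s \<notin> D \<Longrightarrow> b s = 0" for b and c :: "(nat \<Rightarrow> nat) \<Rightarrow> complex"
  proof -
    let ?t = "\<lambda>p. c p * (\<Prod>i = 0..<n. toeplitz_mat l u n b $$ (i, p i))"
    have "?t p = 0" if p: "p permutes {0..<n}" "p \<noteq> q" for p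
    proof -
      have "\<not> (\<forall>i<n. int (p i) - int i \<in> D)"
      proof
        assume "\<forall>i<n. int (p i) - int i \<in> D"
        then have "p i = q i" if "i < n" for i
          using unique[OF p(1)] that by blast
        then have "p = q"
          using permutes_not_in[OF p(1)] permutes_not_in[OF q(1)]
          by (metis atLeastLessThan_iff ext zero_le)
        then show False using p(2) by simp
      qed
      then obtain i where i: "i < n" "int (p i) - int i \<notin> D"
        by blast
      then have "toeplitz_mat l u n b $$ (i, p i) = 0"
        using permutes_in_image[OF p(1), of i] b by (simp add: toeplitz_mat_def)
      then have "(\<Prod>i = 0..<n. toeplitz_mat l u n b $$ (i, p i)) = 0"
        using i by (intro prod_zero) auto
      then show ?thesis by simp
    qed
    then have "(\<Sum>p | p permutes {0..<n}. ?t p) = sum ?t {q}"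
      using q by (intro sum.mono_neutral_right) (auto intro: finite_permutations)
    moreover have "toeplitz_mat l u n b $$ (i, q i) = b (int (q i) - int i)" if "i < n" for i
      using that q(2)[OF that] D permutes_in_image[OF q(1), of i]
      by (auto simp: toeplitz_mat_def)
    ultimately show ?thesis
      by simp
  qed
  let ?a = "\<lambda>s. if s \<in> D then 1 else 0 :: complex"
  have dim: "dim_row (toeplitz_mat l u n b) = n" "dim_col (toeplitz_mat l u n b) = n" for b
    by (simp_all add: toeplitz_mat_def)
  have "permanent (toeplitz_mat l u n ?a) = 1"
    using single[of ?a "\<lambda>_. 1"] q(2) by (simp add: permanent_def dim)
  moreover have "det (toeplitz_mat l u n (\<lambda>s. \<omega> s * ?a s))
      = signof q * (\<Prod>i = 0..<n. \<omega> (int (q i) - int i))"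
    using single[of "\<lambda>s. \<omega> s * ?a s" "\<lambda>p. signof p"] q(2) by (simp add: det_def dim)
  ultimately show ?thesis
    using assms(1) by (simp add: det_convertible_def)
qed

lemma sign_transpose_compose:
  assumes "permutation p" "a \<noteq> b"
  shows "sign (transpose a b \<circ> p) = - sign p"
  using assms by (simp add: sign_compose permutation_swap_id sign_swap_id)

lemma not_det_convertible:
  assumes "l \<ge> 2" "u \<ge> 3"
  shows "\<not> det_convertible l u \<omega>"
proof
  assume conv: "det_convertible l u \<omega>"
  note perm_intros = permutes_compose permutes_swap_id
  note sign_simps = sign_transpose_compose sign_swap_id permutation_compose permutation_swap_id
  have less4: "i < 4 \<longleftrightarrow> i = 0 \<or> i = 1 \<or> i = 2 \<or> i = 3" for i :: nat
    by auto
  have less3: "i < 3 \<longleftrightarrow> i = 0 \<or> i = 1 \<or> i = 2" for i :: nat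
    by auto
  have step2: "\<omega> 1 * \<omega> (-1) = -1"
  proof -
    define q :: "nat \<Rightarrow> nat" where q_def: "q = transpose 0 1"
    have "signof q * (\<Prod>i = 0..<2. \<omega> (int (q i) - int i)) = 1"
    proof (rule det_convertible_unique_permutation[OF conv, where D = "{1, -1}"])
      show "{1, -1} \<subseteq> diagonals l u"
        using assms by (auto simp: diagonals_def)
      show "q permutes {0..<2}"
        unfolding q_def by (intro perm_intros) auto
      show "int (q i) - int i \<in> {1, -1}" if "i < 2" for i
        using that by (auto simp: q_def less_2_cases_iff)
      show "p i = q i" if "p permutes {0..<2}"
        "\<And>i. i < 2 \<Longrightarrow> int (p i) - int i \<in> {1, -1}" "i < 2"
        for p i
        using that(2)[of 0] that(2)[of 1] that(3) permutes_in_image[OF that(1), of 1]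
        by (auto simp: q_def less_2_cases_iff)
    qed
    then show ?thesis
      by (simp add: q_def sign_simps numeral_2_eq_2 minus_equation_iff[of _ 1])
  qed
  have step3: "\<omega> 1 ^ 2 * \<omega> (-2) = 1"
  proof -
    \<comment> \<open>The cycle \<open>0 -> 1 -> 2 -> 0\<close>, factored into transpositions so
      that its sign can be computed.\<close>
    define q :: "nat \<Rightarrow> nat" where q_def: "q = transpose 0 1 \<circ> transpose 1 2"
    have q: "q 0 = 1" "q 1 = 2" "q 2 = 0"
      by (simp_all add: q_def transpose_def)
    have "signof q * (\<Prod>i = 0..<3. \<omega> (int (q i) - int i)) = 1"
    proof (rule det_convertible_unique_permutation[OF conv, where D = "{1, -2}"])
      show "{1, -2} \<subseteq> diagonals l u"
        using assms by (auto simp: diagonals_def)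
      show "q permutes {0..<3}"
        unfolding q_def by (intro perm_intros) auto
      show "int (q i) - int i \<in> {1, -2}" if "i < 3" for i
        using that q unfolding less3 by auto
      show "p i = q i" if "p permutes {0..<3}"
        "\<And>i. i < 3 \<Longrightarrow> int (p i) - int i \<in> {1, -2}" "i < 3"
        for p i
        using that(2)[of 0] that(2)[of 1] that(2)[of 2] that(3) permutes_in_image[OF that(1), of 2] q
        unfolding less3 by auto
    qed
    moreover have "sign q = 1"
      by (simp add: q_def sign_simps)
    moreover have "(\<Prod>i = 0..<3. \<omega> (int (q i) - int i)) = \<omega> 1 ^ 2 * \<omega> (-2)"
      using q by (simp add: eval_nat_numeral)
    ultimately show ?thesis
      by simp
  qed
  have step4: "\<omega> 3 * \<omega> (-1) ^ 3 = -1"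
  proof -
    \<comment> \<open>The cycle \<open>0 -> 3 -> 2 -> 1 -> 0\<close>. In each row the other step in
      \<open>D\<close> leaves the range.\<close>
    define q :: "nat \<Rightarrow> nat" where q_def: "q = transpose 0 3 \<circ> (transpose 3 2 \<circ> transpose 2 1)"
    have q: "q 0 = 3" "q 1 = 0" "q 2 = 1" "q 3 = 2"
      by (simp_all add: q_def transpose_def)
    have "signof q * (\<Prod>i = 0..<4. \<omega> (int (q i) - int i)) = 1"
    proof (rule det_convertible_unique_permutation[OF conv, where D = "{3, -1}"])
      show "{3, -1} \<subseteq> diagonals l u"
        using assms by (auto simp: diagonals_def)
      show "q permutes {0..<4}"
        unfolding q_def by (intro perm_intros) auto
      show "int (q i) - int i \<in> {3, -1}" if "i < 4" for i
        using that q unfolding less4 by auto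
      show "p i = q i" if "p permutes {0..<4}"
        "\<And>i. i < 4 \<Longrightarrow> int (p i) - int i \<in> {3, -1}" "i < 4"
        for p i
        using that(2)[of 0] that(2)[of 1] that(2)[of 2] that(2)[of 3] that(3) q
          permutes_in_image[OF that(1), of 1] permutes_in_image[OF that(1), of 2]
          permutes_in_image[OF that(1), of 3]
        unfolding less4 by auto
    qed
    moreover have "sign q = -1"
      by (simp add: q_def sign_simps)
    moreover have "(\<Prod>i = 0..<4. \<omega> (int (q i) - int i)) = \<omega> 3 * \<omega> (-1) ^ 3"
      using q by (simp add: eval_nat_numeral)
    ultimately show ?thesis
      by (simp add: minus_equation_iff[of _ 1])
  qed
  have step4': "\<omega> 3 * \<omega> 1 * \<omega> (-2) ^ 2 = -1"
  proof -
    \<comment> \<open>The cycle \<open>0 -> 3 -> 1 -> 2 -> 0\<close>.\<close>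
    define q :: "nat \<Rightarrow> nat" where q_def: "q = transpose 0 3 \<circ> (transpose 3 1 \<circ> transpose 1 2)"
    have q: "q 0 = 3" "q 1 = 2" "q 2 = 0" "q 3 = 1"
      by (simp_all add: q_def transpose_def)
    have "signof q * (\<Prod>i = 0..<4. \<omega> (int (q i) - int i)) = 1"
    proof (rule det_convertible_unique_permutation[OF conv, where D = "{3, 1, -2}"])
      show "{3, 1, -2} \<subseteq> diagonals l u"
        using assms by (auto simp: diagonals_def)
      show "q permutes {0..<4}"
        unfolding q_def by (intro perm_intros) auto
      show "int (q i) - int i \<in> {3, 1, -2}" if "i < 4" for i
        using that q unfolding less4 by auto
      show "p i = q i"
        if "p permutes {0..<4}"
        "\<And>i. i < 4 \<Longrightarrow> int (p i) - int i \<in> {3, 1, -2}" "i < 4" for p i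
      proof -
        have "p i < 4" if "i < 4" for i
          using permutes_in_image[OF \<open>p permutes {0..<4}\<close>, of i] that by simp
        note range = this[of 0] this[of 1] this[of 2] this[of 3]
        \<comment> \<open>The range alone fixes rows 1 and 3. Injectivity then excludes
          \<open>p 0 = 1\<close>, and \<open>p 0 = 3\<close> excludes
          \<open>p 2 = 3\<close>.\<close>
        have "p 1 = 2" "p 3 = 1" "p 0 = 1 \<or> p 0 = 3" "p 2 = 0 \<or> p 2 = 3"
          using that(2)[of 0] that(2)[of 1] that(2)[of 2] that(2)[of 3] range by auto
        moreover have "p 0 \<noteq> p 3" "p 0 \<noteq> p 2"
          using permutes_inj[OF that(1)] by (auto dest: injD)
        ultimately show ?thesis
          using that(3) q unfolding less4 by auto
      qed
    qed
    moreover have "sign q = -1"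
      by (simp add: q_def sign_simps)
    moreover have "(\<Prod>i = 0..<4. \<omega> (int (q i) - int i)) = \<omega> 3 * \<omega> 1 * \<omega> (-2) ^ 2"
      using q by (simp add: eval_nat_numeral)
    ultimately show ?thesis
      by (simp add: minus_equation_iff[of _ 1])
  qed
  \<comment> \<open>Inserting the square of \<open>step3\<close> yields
    \<open>\<omega> 3 = - (\<omega> 1 ^ 3)\<close> without dividing by any weight. Then
    \<open>step2\<close> makes \<open>\<omega> 3 * \<omega> (-1) ^ 3\<close> equal to 1, against
    \<open>step4\<close>.\<close>
  have "\<omega> 3 = \<omega> 3 * (\<omega> 1 ^ 2 * \<omega> (-2)) ^ 2"
    by (simp add: step3)
  also have "\<dots> = \<omega> 1 ^ 3 * (\<omega> 3 * \<omega> 1 * \<omega> (-2) ^ 2)"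
    by (simp add: power2_eq_square power3_eq_cube mult_ac)
  also have "\<dots> = - (\<omega> 1 ^ 3)"
    by (simp add: step4')
  finally have "\<omega> 3 * \<omega> (-1) ^ 3 = - ((\<omega> 1 * \<omega> (-1)) ^ 3)"
    by (simp add: power_mult_distrib)
  then show False
    using step2 step4 by simp
qed

theorem theorem4p15:
  fixes l u :: nat
  assumes "l \<ge> 1" and "u \<ge> 1"
  shows "(\<exists>\<omega> :: int \<Rightarrow> complex. \<forall>(n :: nat) (a :: int \<Rightarrow> complex).
            permanent (toeplitz_mat l u n a) = det (toeplitz_mat l u n (\<lambda>s. \<omega> s * a s)))
         \<longleftrightarrow> min l u = 1 \<or> (l, u) = (2, 2)"
proof -
  have "(\<exists>\<omega>. det_convertible l u \<omega>) \<longleftrightarrow> min l u = 1 \<or> (l, u) = (2, 2)"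
  proof
    assume "\<exists>\<omega>. det_convertible l u \<omega>"
    \<comment> \<open>The second exclusion is the first one transposed. Together they leave only (2,
      2) when both bounds are at least 2.\<close>
    then have "\<not> (l \<ge> 2 \<and> u \<ge> 3)" "\<not> (u \<ge> 2 \<and> l \<ge> 3)"
      using not_det_convertible det_convertible_swap by blast+
    then show "min l u = 1 \<or> (l, u) = (2, 2)"
      using assms by auto
  next
    assume "min l u = 1 \<or> (l, u) = (2, 2)"
    then consider "l = 1" | "u = 1" | "l = 2" "u = 2"
      using assms by (auto simp: min_def split: if_splits)
    then show "\<exists>\<omega>. det_convertible l u \<omega>"
      using det_convertible_hessenberg det_convertible_swap det_convertible_pentadiagonal
      by cases blast+
  qed
  then show ?thesis
    by (simp add: det_convertible_def)
qed

end
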